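(* Let $\mathbf{d}$ and $\mathbf{e}$ be distances on a set $X$. The following are equivalent. (1) $X$ is $\mathbf{e}^\circ_\circ$-complete, $X$ is $\mathbf{d}$-$\mathbf{e}^\circ_\circ$-continuous, and $\mathbf{d}={}^\circ_\circ\mathbf{e}$. (2) $X$ is $\mathbf{d}^\bullet_\circ$-complete, $X$ is $\mathbf{d}^\bullet_\circ$-continuous, and $\mathbf{e}=\underline{\mathbf{d}}\geq\overline{\mathbf{d}}$.
   Context: Suprema and infima are taken in $[0,\infty]$, with $\sup\emptyset=0$, $\inf\emptyset=\infty$; for $a,b\in[0,\infty]$, $(a-b)_+=\min\{c\in[0,\infty]:a\leq b+c\}$. A distance on $X$ is a function $\mathbf{d}:X\times X\to[0,\infty]$, written $x\mathbf{d}y$, with $x\mathbf{d}z\leq x\mathbf{d}y+y\mathbf{d}z$ for all $x,y,z$ (no symmetry, and $x\mathbf{d}x=0$ is not required). Functions are ordered pointwise. The upper and lower hemimetrics are $x\overline{\mathbf{d}}z=\sup_{y\in X}(x\mathbf{d}y-z\mathbf{d}y)_+$ and $z\underline{\mathbf{d}}y=\sup_{x\in X}(x\mathbf{d}y-x\mathbf{d}z)_+$. A net is a family $(x_\lambda)_{\lambda\in\Lambda}$ indexed by a non-empty set with a transitive (not necessarily reflexive) relation $\prec$ such that any two elements $\gamma,\delta$ have some $\lambda$ with $\gamma,\delta\prec\lambda$; limits, $\limsup_\lambda r_\lambda=\inf_\gamma\sup_{\gamma\prec\lambda}r_\lambda$, $\liminf$ and topological convergence are taken along $\prec$. It is $\mathbf{d}$-Cauchy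 if $\lim_\gamma\sup_{\gamma\prec\delta}x_\gamma\mathbf{d}x_\delta=0$ (similarly $\mathbf{e}$-Cauchy). The Smyth topology $\mathbf{d}^\bullet_\circ$ is generated by the sets $\{x:c\mathbf{d}x<r\}$ and $\{x:c\mathbf{d}x>r\}$; the Yoneda topology $\mathbf{e}^\circ_\circ$ is generated by the sets $\{x:x\mathbf{e}c>r\}$ and $\{x:c\mathbf{e}x>r\}$ ($c\in X$, $r$ real). $X$ is $\mathbf{d}^\bullet_\circ$-complete if every $\mathbf{d}$-Cauchy net in $X$ has a $\mathbf{d}^\bullet_\circ$-limit in $X$, and $\mathbf{e}^\circ_\circ$-complete if every $\mathbf{e}$-Cauchy net in $X$ has an $\mathbf{e}^\circ_\circ$-limit in $X$. $X$ is $\mathbf{d}^\bullet_\circ$-continuous if every $x\in X$ is a $\mathbf{d}^\bullet_\circ$-limit of some $\mathbf{d}$-Cauchy net in $X$, and $\mathbf{d}$-$\mathbf{e}^\circ_\circ$-continuous if every $x\in X$ is an $\mathbf{e}^\circ_\circ$-limit of some $\mathbf{d}$-Cauchy net in $X$. The way-below distance ${}^\circ_\circ\mathbf{e}$ is defined by ${}^\circ_\circ\mathbf{e}(x,y)=\sup\{(\liminf_\lambda x\mathbf{e}z_\lambda-y\mathbf{e}z)_+\}$, the supremum being over all $z\in X$ and all $\mathbf{e}$-Cauchy nets $(z_\lambda)$ in $X$ converging to $z$ in the topology $\mathbf{e}^\circ_\circ$.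
   Formalization: Condition (1) additionally requires xex=0 for all x in X; without it the claim fails (one point, d=0, e=1), and (2) implies it. Nets are indexed by subsets of an arbitrary fixed infinite set of cardinality at least that of X, the same in both conditions. *)

theory Defs
  imports "HOL-Analysis.Analysis" "HOL-Library.Equipollence"
begin

section \<open>Distances\<close>

text \<open>The library subtraction on \<^typ>\<open>ennreal\<close> has \<open>\<infinity> - \<infinity> = \<infinity>\<close>, whereas here \<open>(\<infinity> - \<infinity>)\<^sub>+ = 0\<close>.
  The infimum below is a minimum: see \<open>le_add_pos_diff\<close>.\<close>

definition pos_diff :: "ennreal \<Rightarrow> ennreal \<Rightarrow> ennreal" where
  "pos_diff a b = Inf {c. a \<le> b + c}"

lemma pos_diff_le_iff: "pos_diff a b \<le> c \<longleftrightarrow> a \<le> b + c"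
proof
  assume c: "pos_diff a b \<le> c"
  show "a \<le> b + c"
  proof (cases "b = top")
    case False
    then have "a - b \<le> pos_diff a b"
      unfolding pos_diff_def by (intro Inf_greatest) (simp add: ennreal_minus_le_iff)
    with c have "a - b \<le> c" by (rule order_trans[rotated])
    with False show ?thesis by (simp add: ennreal_minus_le_iff)
  qed simp
next
  assume "a \<le> b + c"
  then show "pos_diff a b \<le> c" unfolding pos_diff_def by (auto intro: Inf_lower)
qed

lemma le_add_pos_diff: "a \<le> b + pos_diff a b"
  using pos_diff_le_iff by blast

definition distance_on :: "'a set \<Rightarrow> ('a \<Rightarrow> 'a \<Rightarrow> ennreal) \<Rightarrow> bool" where
  "distance_on X d \<longleftrightarrow> (\<forall>x\<in>X. \<forall>y\<in>X. \<forall>z\<in>X. d x z \<le> d x y + d y z)"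

definition upper_hemimetric :: "'a set \<Rightarrow> ('a \<Rightarrow> 'a \<Rightarrow> ennreal) \<Rightarrow> 'a \<Rightarrow> 'a \<Rightarrow> ennreal" where
  "upper_hemimetric X d x z = (SUP y\<in>X. pos_diff (d x y) (d z y))"

definition lower_hemimetric :: "'a set \<Rightarrow> ('a \<Rightarrow> 'a \<Rightarrow> ennreal) \<Rightarrow> 'a \<Rightarrow> 'a \<Rightarrow> ennreal" where
  "lower_hemimetric X d z y = (SUP x\<in>X. pos_diff (d x y) (d x z))"

section \<open>Nets\<close>

text \<open>A net consists of an index set \<open>L\<close>, a relation \<open>R\<close> on it (\<open>R \<gamma> \<delta>\<close> is \<open>\<gamma> \<prec> \<delta>\<close>) that need not be
  reflexive, and a family \<open>x\<close>, of which only the values on \<open>L\<close> matter.\<close>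

definition net_on :: "'a set \<Rightarrow> 'i set \<Rightarrow> ('i \<Rightarrow> 'i \<Rightarrow> bool) \<Rightarrow> ('i \<Rightarrow> 'a) \<Rightarrow> bool" where
  "net_on X L R x \<longleftrightarrow> L \<noteq> {} \<and> transp_on L R \<and>
     (\<forall>\<gamma>\<in>L. \<forall>\<delta>\<in>L. \<exists>l\<in>L. R \<gamma> l \<and> R \<delta> l) \<and> x ` L \<subseteq> X"

text \<open>Limits, \<^const>\<open>Limsup\<close>, \<^const>\<open>Liminf\<close> and topological convergence along \<open>\<prec>\<close> are the library
  notions for this filter; see \<open>eventually_net_filter\<close>, \<open>Limsup_net_filter\<close> and
  \<open>Liminf_net_filter\<close>.\<close>

definition net_filter :: "'i set \<Rightarrow> ('i \<Rightarrow> 'i \<Rightarrow> bool) \<Rightarrow> 'i filter" where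
  "net_filter L R = (INF \<gamma>\<in>L. principal {l\<in>L. R \<gamma> l})"

lemma eventually_net_filter:
  assumes "net_on X L R x"
  shows "eventually P (net_filter L R) \<longleftrightarrow> (\<exists>\<gamma>\<in>L. \<forall>l\<in>L. R \<gamma> l \<longrightarrow> P l)"
proof -
  have "\<exists>l\<in>L. principal {k\<in>L. R l k} \<le> inf (principal {k\<in>L. R \<gamma> k}) (principal {k\<in>L. R \<delta> k})"
    if gd: "\<gamma> \<in> L" "\<delta> \<in> L" for \<gamma> \<delta>
  proof -
    from gd assms obtain l where l: "l \<in> L" "R \<gamma> l" "R \<delta> l"
      unfolding net_on_def by meson
    moreover have "transp_on L R" using assms by (simp add: net_on_def)
    ultimately have "{k\<in>L. R l k} \<subseteq> {k\<in>L. R \<gamma> k} \<inter> {k\<in>L. R \<delta> k}"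
      using gd by (auto dest: transp_onD)
    then show ?thesis using l by (auto intro!: bexI[of _ l])
  qed
  moreover have "L \<noteq> {}" using assms by (simp add: net_on_def)
  ultimately show ?thesis
    unfolding net_filter_def by (subst eventually_INF_base) (auto simp: eventually_principal)
qed

lemma Limsup_net_filter:
  fixes r :: "'i \<Rightarrow> 'b :: complete_lattice"
  assumes "net_on X L R x"
  shows "Limsup (net_filter L R) r = (INF \<gamma>\<in>L. SUP l\<in>{l\<in>L. R \<gamma> l}. r l)"
proof (rule antisym)
  show "Limsup (net_filter L R) r \<le> (INF \<gamma>\<in>L. SUP l\<in>{l\<in>L. R \<gamma> l}. r l)"
  proof (rule INF_greatest)
    fix \<gamma> assume "\<gamma> \<in> L"
    then have "eventually (\<lambda>l. l \<in> {l\<in>L. R \<gamma> l}) (net_filter L R)"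
      unfolding eventually_net_filter[OF assms] by auto
    then show "Limsup (net_filter L R) r \<le> (SUP l\<in>{l\<in>L. R \<gamma> l}. r l)"
      by (auto intro!: Limsup_bounded elim!: eventually_mono intro: SUP_upper)
  qed
  show "(INF \<gamma>\<in>L. SUP l\<in>{l\<in>L. R \<gamma> l}. r l) \<le> Limsup (net_filter L R) r"
    unfolding Limsup_def
  proof (rule INF_greatest, clarsimp)
    fix P assume "eventually P (net_filter L R)"
    then obtain \<gamma> where "\<gamma> \<in> L" "\<forall>l\<in>L. R \<gamma> l \<longrightarrow> P l"
      unfolding eventually_net_filter[OF assms] by auto
    then show "(INF \<gamma>\<in>L. SUP l\<in>{l\<in>L. R \<gamma> l}. r l) \<le> (SUP l\<in>Collect P. r l)"
      by (auto intro!: INF_lower2[of \<gamma>] SUP_subset_mono)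
  qed
qed

lemma Liminf_net_filter:
  fixes r :: "'i \<Rightarrow> 'b :: complete_lattice"
  assumes "net_on X L R x"
  shows "Liminf (net_filter L R) r = (SUP \<gamma>\<in>L. INF l\<in>{l\<in>L. R \<gamma> l}. r l)"
proof (rule antisym)
  show "(SUP \<gamma>\<in>L. INF l\<in>{l\<in>L. R \<gamma> l}. r l) \<le> Liminf (net_filter L R) r"
  proof (rule SUP_least)
    fix \<gamma> assume "\<gamma> \<in> L"
    then have "eventually (\<lambda>l. l \<in> {l\<in>L. R \<gamma> l}) (net_filter L R)"
      unfolding eventually_net_filter[OF assms] by auto
    then show "(INF l\<in>{l\<in>L. R \<gamma> l}. r l) \<le> Liminf (net_filter L R) r"
      by (auto intro!: Liminf_bounded elim!: eventually_mono intro: INF_lower)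
  qed
  show "Liminf (net_filter L R) r \<le> (SUP \<gamma>\<in>L. INF l\<in>{l\<in>L. R \<gamma> l}. r l)"
    unfolding Liminf_def
  proof (rule SUP_least, clarsimp)
    fix P assume "eventually P (net_filter L R)"
    then obtain \<gamma> where "\<gamma> \<in> L" "\<forall>l\<in>L. R \<gamma> l \<longrightarrow> P l"
      unfolding eventually_net_filter[OF assms] by auto
    then show "(INF l\<in>Collect P. r l) \<le> (SUP \<gamma>\<in>L. INF l\<in>{l\<in>L. R \<gamma> l}. r l)"
      by (auto intro!: SUP_upper2[of \<gamma>] INF_superset_mono)
  qed
qed

definition cauchy_net ::
  "('a \<Rightarrow> 'a \<Rightarrow> ennreal) \<Rightarrow> 'i set \<Rightarrow> ('i \<Rightarrow> 'i \<Rightarrow> bool) \<Rightarrow> ('i \<Rightarrow> 'a) \<Rightarrow> bool" where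
  "cauchy_net d L R x \<longleftrightarrow>
     ((\<lambda>\<gamma>. SUP \<delta>\<in>{\<delta>\<in>L. R \<gamma> \<delta>}. d (x \<gamma>) (x \<delta>)) \<longlongrightarrow> 0) (net_filter L R)"

section \<open>Topologies\<close>

text \<open>Comparisons with a real \<open>r\<close> are made in \<^typ>\<open>ereal\<close>, because \<^const>\<open>ennreal\<close> sends negative reals
  to \<open>0\<close>. Taking \<open>r < 0\<close> shows that both topologies have underlying set \<open>X\<close>.\<close>

definition smyth_topology :: "'a set \<Rightarrow> ('a \<Rightarrow> 'a \<Rightarrow> ennreal) \<Rightarrow> 'a topology" where
  "smyth_topology X d = topology_generated_by
     ({{x\<in>X. enn2ereal (d c x) < ereal r} | c r. c \<in> X} \<union>
      {{x\<in>X. enn2ereal (d c x) > ereal r} | c r. c \<in> X})"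

definition yoneda_topology :: "'a set \<Rightarrow> ('a \<Rightarrow> 'a \<Rightarrow> ennreal) \<Rightarrow> 'a topology" where
  "yoneda_topology X e = topology_generated_by
     ({{x\<in>X. enn2ereal (e x c) > ereal r} | c r. c \<in> X} \<union>
      {{x\<in>X. enn2ereal (e c x) > ereal r} | c r. c \<in> X})"

lemma enn2ereal_gt_neg1: "enn2ereal a > ereal (-1)"
  by (rule less_le_trans[OF _ enn2ereal_nonneg]) simp

lemma topspace_smyth_topology: "topspace (smyth_topology X d) = X"
proof -
  have "x \<in> topspace (smyth_topology X d)" if "x \<in> X" for x
  proof -
    have "x \<in> {y\<in>X. enn2ereal (d x y) > ereal (-1)}"
      using that enn2ereal_gt_neg1 by simp
    then show ?thesis
      unfolding smyth_topology_def topology_generated_by_topspace using that by blast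
  qed
  moreover have "topspace (smyth_topology X d) \<subseteq> X"
    unfolding smyth_topology_def topology_generated_by_topspace by blast
  ultimately show ?thesis by blast
qed

lemma topspace_yoneda_topology: "topspace (yoneda_topology X e) = X"
proof -
  have "x \<in> topspace (yoneda_topology X e)" if "x \<in> X" for x
  proof -
    have "x \<in> {y\<in>X. enn2ereal (e x y) > ereal (-1)}"
      using that enn2ereal_gt_neg1 by simp
    then show ?thesis
      unfolding yoneda_topology_def topology_generated_by_topspace using that by blast
  qed
  moreover have "topspace (yoneda_topology X e) \<subseteq> X"
    unfolding yoneda_topology_def topology_generated_by_topspace by blast
  ultimately show ?thesis by blast
qed

section \<open>Completeness, continuity and the way-below distance\<close>

text \<open>Nets are quantified over those indexed by subsets of a type \<open>'i\<close>, passed as a type argument.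
  This loses nothing once \<open>'i\<close> is infinite and \<open>card X \<le> card 'i\<close>: along a Cauchy net \<open>x\<close> the distances
  \<open>d c (x l)\<close> and \<open>d (x l) c\<close> converge, and one can pick a net indexed by finite subsets of
  \<open>X \<times> nat\<close> which is again Cauchy, has the same limits of distances, and preserves any given
  topological limit. Types \<open>'i\<close> smaller than this would be too small for the definitions to be
  meaningful.\<close>

definition net_complete ::
  "'i itself \<Rightarrow> 'a set \<Rightarrow> ('a \<Rightarrow> 'a \<Rightarrow> ennreal) \<Rightarrow> 'a topology \<Rightarrow> bool" where
  "net_complete _ X d T \<longleftrightarrow>
     (\<forall>(L :: 'i set) R x. net_on X L R x \<and> cauchy_net d L R x \<longrightarrow>
        (\<exists>l\<in>X. limitin T x l (net_filter L R)))"

definition net_continuous ::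
  "'i itself \<Rightarrow> 'a set \<Rightarrow> ('a \<Rightarrow> 'a \<Rightarrow> ennreal) \<Rightarrow> 'a topology \<Rightarrow> bool" where
  "net_continuous _ X d T \<longleftrightarrow>
     (\<forall>l\<in>X. \<exists>(L :: 'i set) R x. net_on X L R x \<and> cauchy_net d L R x \<and>
        limitin T x l (net_filter L R))"

definition way_below ::
  "'i itself \<Rightarrow> 'a set \<Rightarrow> ('a \<Rightarrow> 'a \<Rightarrow> ennreal) \<Rightarrow> 'a \<Rightarrow> 'a \<Rightarrow> ennreal" where
  "way_below _ X e x y = Sup {pos_diff (Liminf (net_filter L R) (\<lambda>l. e x (w l))) (e y z)
     | z (L :: 'i set) R w. z \<in> X \<and> net_on X L R w \<and> cauchy_net e L R w \<and>
         limitin (yoneda_topology X e) w z (net_filter L R)}"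

section \<open>Self-distance zero\<close>

text \<open>The completeness, continuity and way-below conditions, with no requirement on \<open>e x x\<close>, do not
  imply \<open>e = lower_hemimetric X d\<close>: on one point with \<open>d = 0\<close> and \<open>e = 1\<close> there are no \<open>e\<close>-Cauchy
  nets at all, so \<open>e\<close>-completeness holds vacuously and the way-below distance is \<open>0\<close>. Since
  \<open>lower_hemimetric X d x x = 0\<close> always, \<open>e x x = 0\<close> is also necessary for that conclusion.\<close>

lemma lower_hemimetric_self: "lower_hemimetric X d x x = 0"
proof -
  have "pos_diff a a = 0" for a
    using pos_diff_le_iff[of a a 0] by simp
  then have "lower_hemimetric X d x x \<le> 0"
    unfolding lower_hemimetric_def by (intro SUP_least) simp
  then show ?thesis by simp
qed

lemma no_cauchy_net_const_1:
  assumes "net_on X L R x"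
  shows "\<not> cauchy_net (\<lambda>_ _. 1) L R x"
proof
  assume "cauchy_net (\<lambda>_ _. 1) L R x"
  then have "eventually (\<lambda>\<gamma>. (SUP \<delta>\<in>{\<delta>\<in>L. R \<gamma> \<delta>}. 1 :: ennreal) < 1) (net_filter L R)"
    unfolding cauchy_net_def by (rule order_tendstoD) simp
  then obtain \<gamma> where g: "\<gamma> \<in> L" "\<forall>l\<in>L. R \<gamma> l \<longrightarrow> (SUP \<delta>\<in>{\<delta>\<in>L. R l \<delta>}. 1 :: ennreal) < 1"
    unfolding eventually_net_filter[OF assms] by auto
  from g(1) assms obtain l where l: "l \<in> L" "R \<gamma> l" unfolding net_on_def by meson
  from l(1) assms obtain k where k: "k \<in> L" "R l k" unfolding net_on_def by meson
  have "(1::ennreal) \<le> (SUP \<delta>\<in>{\<delta>\<in>L. R l \<delta>}. 1)"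
    using k by (intro SUP_upper2[of k]) auto
  with g(2) l show False by (metis not_le)
qed

lemma self_distance_counterexample:
  defines "X \<equiv> {()}" and "d \<equiv> \<lambda>_ _. 0 :: ennreal" and "e \<equiv> \<lambda>_ _. 1 :: ennreal"
  shows "distance_on X d" "distance_on X e"
    and "net_complete TYPE('i) X e (yoneda_topology X e)"
    and "net_continuous TYPE('i) X d (yoneda_topology X e)"
    and "\<forall>x\<in>X. \<forall>y\<in>X. d x y = way_below TYPE('i) X e x y"
    and "\<not> (\<forall>x\<in>X. \<forall>y\<in>X. e x y = lower_hemimetric X d x y)"
proof -
  show "distance_on X d" "distance_on X e"
    by (simp_all add: distance_on_def d_def e_def)
  show "net_complete TYPE('i) X e (yoneda_topology X e)"
    by (auto simp: net_complete_def e_def dest: no_cauchy_net_const_1)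
  show "\<not> (\<forall>x\<in>X. \<forall>y\<in>X. e x y = lower_hemimetric X d x y)"
    by (auto simp: lower_hemimetric_self e_def X_def)
  show "\<forall>x\<in>X. \<forall>y\<in>X. d x y = way_below TYPE('i) X e x y"
  proof -
    have "way_below TYPE('i) X e x y = Sup {}" for x y
      unfolding way_below_def e_def using no_cauchy_net_const_1
      by (intro arg_cong[where f = Sup]) blast
    then show ?thesis by (simp add: d_def bot_ennreal)
  qed
  show "net_continuous TYPE('i) X d (yoneda_topology X e)"
    unfolding net_continuous_def
  proof
    fix l assume l: "l \<in> X"
    let ?L = "{undefined :: 'i}" and ?R = "\<lambda>_ _ :: 'i. True"
    have "net_on X ?L ?R (\<lambda>_. l)"
      using l by (auto simp: net_on_def transp_on_def)
    moreover have "cauchy_net d ?L ?R (\<lambda>_. l)"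
      by (simp add: cauchy_net_def d_def)
    moreover have "limitin (yoneda_topology X e) (\<lambda>_. l) l (net_filter ?L ?R)"
      using l by (simp add: topspace_yoneda_topology)
    ultimately show "\<exists>(L :: 'i set) R x. net_on X L R x \<and> cauchy_net d L R x \<and>
        limitin (yoneda_topology X e) x l (net_filter L R)"
      by blast
  qed
qed

end

theory Submission
  imports Defs
begin

text \<open>
  Under either condition \<open>d\<close> and \<open>e\<close> compose on both sides, \<open>d b y \<le> d b x + e x y\<close> and
  \<open>d x b \<le> e x y + d y b\<close>, and \<open>e \<le> d\<close>, so that \<open>d\<close>-Cauchy nets are \<open>e\<close>-Cauchy. The proof rests on
  these inequalities and on turning the one kind of limit into the other.

  From Yoneda to Smyth, the two composition inequalities are inherited from the triangle inequality
  of \<open>e\<close> by the way-below distance, and testing the way-below distance with constant nets gives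
  \<open>e \<le> d\<close>. Let a \<open>d\<close>-Cauchy net \<open>x\<close> have the Yoneda limit \<open>l\<close>. Then \<open>e (x i) l\<close> tends to \<open>0\<close>, so
  \<open>d c l \<le> d c (x i) + e (x i) l\<close> bounds \<open>d c l\<close> by the limit of \<open>d c (x i)\<close>. Conversely the net \<open>x\<close>
  itself competes in the supremum that defines \<open>d c l\<close>, so that \<open>liminf e c (x i) \<le> d c l\<close>, and
  \<open>d c (x j) \<le> e c (x i) + d (x i) (x j)\<close> replaces \<open>e\<close> by \<open>d\<close> there. This is
  \<open>smyth_limit_of_yoneda_limit\<close>, from which completeness and continuity follow; approximating the
  first argument by a \<open>d\<close>-Cauchy net then shows that \<open>e\<close> is at most the lower hemimetric.

  From Smyth to Yoneda, the difficulty is completeness, since an \<open>e\<close>-Cauchy net \<open>x\<close> need not be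
  \<open>d\<close>-Cauchy. The distances \<open>d c (x i)\<close> do converge, to \<open>f c\<close> say. Continuity yields points \<open>w\<close> with
  \<open>f w\<close> small and with \<open>d c w\<close> hardly above \<open>f c\<close> for any two prescribed \<open>c\<close> (\<open>interpolation\<close>).
  Hence the formal balls \<open>(w, r)\<close> with \<open>f w < r\<close>, ordered by \<open>d w v + s < r\<close>, are directed, and
  their centres form a \<open>d\<close>-Cauchy net along which \<open>d c\<close> tends to \<open>f c\<close> (\<open>formal_ball_net\<close>).
  Its Smyth limit \<open>l\<close> satisfies \<open>d c l = f c\<close>, and because \<open>e\<close> is the lower hemimetric this alone
  makes \<open>l\<close> a Yoneda limit of \<open>x\<close> (\<open>yoneda_limit_of_pointwise_limit\<close>). The identification of \<open>d\<close>
  with the way-below distance uses such a limit again, now for an \<open>e\<close>-Cauchy net that already has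
  a Yoneda limit \<open>z\<close>: the two limits are at \<open>e\<close>-distance \<open>0\<close>, so \<open>f \<le> d _ z\<close>.
\<close>

section \<open>Limits in the extended non-negative reals\<close>

lemma ereal_less_enn2ereal_iff: "ereal r < enn2ereal a \<longleftrightarrow> r < 0 \<or> ennreal r < a"
proof (cases "r < 0")
  case True
  then have "ereal r < enn2ereal a" by (intro less_le_trans[OF _ enn2ereal_nonneg]) simp
  with True show ?thesis by simp
next
  case False
  then show ?thesis by (simp add: less_ennreal.rep_eq enn2ereal_ennreal)
qed

lemma enn2ereal_less_ereal_iff: "enn2ereal a < ereal r \<longleftrightarrow> a < ennreal r"
proof (cases "r < 0")
  case True
  then have "\<not> enn2ereal a < ereal r"
    using enn2ereal_nonneg[of a] by (cases "enn2ereal a") auto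
  moreover have "ennreal r = 0" using True by (simp add: ennreal_neg)
  ultimately show ?thesis by simp
next
  case False
  then show ?thesis by (simp add: less_ennreal.rep_eq enn2ereal_ennreal)
qed

lemma ennreal_half_pos:
  fixes \<epsilon> :: ennreal
  assumes "0 < \<epsilon>"
  obtains \<eta> where "0 < \<eta>" "\<eta> + \<eta> \<le> \<epsilon>"
proof (cases \<epsilon>)
  case (real r)
  then show thesis using assms that[of "ennreal (r / 2)"]
    by (simp add: ennreal_plus[symmetric] del: ennreal_plus)
next
  case top
  then show thesis using that[of 1] by simp
qed

lemma eventually_le_add_of_tendsto:
  fixes f :: "'i \<Rightarrow> ennreal"
  assumes "(f \<longlongrightarrow> l) F" and "0 < \<epsilon>"
  shows "\<forall>\<^sub>F i in F. f i \<le> l + \<epsilon>"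
proof (cases "l = top")
  case False
  then have "l < l + \<epsilon>" using assms(2) by (simp add: ennreal_add_left_cancel_less less_top)
  with assms(1) have "\<forall>\<^sub>F i in F. f i < l + \<epsilon>" by (rule order_tendstoD)
  then show ?thesis by (rule eventually_mono) simp
qed simp

text \<open>The form in which inequalities between distances are passed to the limit. Addition on
  \<^typ>\<open>ennreal\<close> has no cancellation at \<open>\<infinity>\<close>, so the summand \<open>k\<close> is moved to the left by
  \<^const>\<open>pos_diff\<close>, which turns the inequality into a constant lower bound of \<open>h\<close>.\<close>

lemma limit_le_add_Liminf:
  fixes g k h :: "'i \<Rightarrow> ennreal"
  assumes g: "(g \<longlongrightarrow> l) F" and k: "(k \<longlongrightarrow> m) F"
    and le: "\<forall>\<^sub>F i in F. g i \<le> k i + h i"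
  shows "l \<le> m + Liminf F h"
proof (rule dense_le)
  fix y assume "y < l"
  with g have y: "\<forall>\<^sub>F i in F. y < g i" by (rule order_tendstoD)
  show "y \<le> m + Liminf F h"
  proof (rule ennreal_le_epsilon)
    fix r :: real assume "0 < r"
    with k have "\<forall>\<^sub>F i in F. k i \<le> m + ennreal r"
      by (intro eventually_le_add_of_tendsto) simp_all
    with y le have "\<forall>\<^sub>F i in F. pos_diff y (m + ennreal r) \<le> h i"
    proof eventually_elim
      case (elim i)
      then have "y \<le> k i + h i" by simp
      also have "\<dots> \<le> m + ennreal r + h i" using elim by (intro add_right_mono)
      finally show ?case by (simp add: pos_diff_le_iff)
    qed
    then have "pos_diff y (m + ennreal r) \<le> Liminf F h" by (rule Liminf_bounded)
    then show "y \<le> m + Liminf F h + ennreal r"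
      by (simp add: pos_diff_le_iff ac_simps)
  qed
qed

section \<open>Subbasic descriptions of convergence\<close>

lemma limitin_topology_generated_by:
  "limitin (topology_generated_by S) x l F \<longleftrightarrow>
     l \<in> \<Union>S \<and> (\<forall>U\<in>S. l \<in> U \<longrightarrow> (\<forall>\<^sub>F i in F. x i \<in> U))" (is "?L \<longleftrightarrow> ?R")
proof
  assume ?L
  then show ?R
    unfolding limitin_def using topology_generated_by_Basis by (metis topology_generated_by_topspace)
next
  assume R: ?R
  have "l \<in> U \<longrightarrow> (\<forall>\<^sub>F i in F. x i \<in> U)" if "generate_topology_on S U" for U
    using that
  proof induction
    case (UN K)
    show ?case
    proof
      assume "l \<in> \<Union>K"
      then obtain k where k: "k \<in> K" "l \<in> k" by blast
      with UN.IH have "\<forall>\<^sub>F i in F. x i \<in> k" by blast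
      then show "\<forall>\<^sub>F i in F. x i \<in> \<Union>K" by (rule eventually_mono) (use k in blast)
    qed
  qed (use R in \<open>auto simp: eventually_conj_iff\<close>)
  with R show ?L
    unfolding limitin_def openin_topology_generated_by_iff by simp
qed

text \<open>Subbasic sets compare with a real, which by density is as good as comparing with an element of
  \<^typ>\<open>ennreal\<close>; the upper and lower sets together make \<open>d c\<close> continuous for every \<open>c\<close>.\<close>

lemma limitin_smyth_topology:
  assumes "\<forall>\<^sub>F i in F. x i \<in> X"
  shows "limitin (smyth_topology X d) x l F \<longleftrightarrow>
    l \<in> X \<and> (\<forall>c\<in>X. ((\<lambda>i. d c (x i)) \<longlongrightarrow> d c l) F)" (is "?L \<longleftrightarrow> ?R")
proof
  assume L: ?L
  then have l: "l \<in> X"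
    using limitin_topspace topspace_smyth_topology by metis
  have ev: "\<forall>\<^sub>F i in F. x i \<in> U"
    if "l \<in> U" "U \<in> {{x\<in>X. enn2ereal (d c x) < ereal r} | c r. c \<in> X} \<union>
      {{x\<in>X. enn2ereal (d c x) > ereal r} | c r. c \<in> X}" for U
    using L[unfolded smyth_topology_def limitin_topology_generated_by, THEN conjunct2, THEN bspec,
      OF that(2), THEN mp, OF that(1)] .
  have "((\<lambda>i. d c (x i)) \<longlongrightarrow> d c l) F" if c: "c \<in> X" for c
  proof (rule order_tendstoI)
    fix a assume "a < d c l"
    then obtain r where r: "enn2ereal a < ereal r" "ereal r < enn2ereal (d c l)"
      using ereal_dense2 by (auto simp: less_ennreal.rep_eq)
    have "\<forall>\<^sub>F i in F. x i \<in> {x\<in>X. enn2ereal (d c x) > ereal r}"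
      by (rule ev) (use l c r in auto)
    then show "\<forall>\<^sub>F i in F. a < d c (x i)"
      by (rule eventually_mono) (use r in \<open>auto simp: less_ennreal.rep_eq\<close>)
  next
    fix a assume "d c l < a"
    then obtain r where r: "enn2ereal (d c l) < ereal r" "ereal r < enn2ereal a"
      using ereal_dense2 by (auto simp: less_ennreal.rep_eq)
    have "\<forall>\<^sub>F i in F. x i \<in> {x\<in>X. enn2ereal (d c x) < ereal r}"
      by (rule ev) (use l c r in auto)
    then show "\<forall>\<^sub>F i in F. d c (x i) < a"
      by (rule eventually_mono) (use r in \<open>auto simp: less_ennreal.rep_eq\<close>)
  qed
  with l show ?R by blast
next
  assume R: ?R
  have l: "l \<in> topspace (smyth_topology X d)" using R by (simp add: topspace_smyth_topology)
  have below: "\<forall>\<^sub>F i in F. x i \<in> {x\<in>X. enn2ereal (d c x) < ereal r}"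
    if "c \<in> X" "enn2ereal (d c l) < ereal r" for c r
  proof -
    have "\<forall>\<^sub>F i in F. d c (x i) < ennreal r"
      using R that by (intro order_tendstoD) (auto simp: enn2ereal_less_ereal_iff)
    with assms show ?thesis by eventually_elim (simp add: enn2ereal_less_ereal_iff)
  qed
  have above: "\<forall>\<^sub>F i in F. x i \<in> {x\<in>X. enn2ereal (d c x) > ereal r}"
    if "c \<in> X" "enn2ereal (d c l) > ereal r" for c r
  proof -
    have "\<forall>\<^sub>F i in F. r < 0 \<or> d c (x i) > ennreal r"
    proof (cases "r < 0")
      case False
      then have "\<forall>\<^sub>F i in F. d c (x i) > ennreal r"
        using R that by (intro order_tendstoD) (auto simp: ereal_less_enn2ereal_iff)
      then show ?thesis by (rule eventually_mono) simp
    qed simp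
    with assms show ?thesis by eventually_elim (simp add: ereal_less_enn2ereal_iff)
  qed
  show ?L
    unfolding smyth_topology_def limitin_topology_generated_by
  proof (intro conjI ballI impI)
    fix U
    assume U: "U \<in> {{x\<in>X. enn2ereal (d c x) < ereal r} | c r. c \<in> X} \<union>
      {{x\<in>X. enn2ereal (d c x) > ereal r} | c r. c \<in> X}" and "l \<in> U"
    from U show "\<forall>\<^sub>F i in F. x i \<in> U"
      by (elim UnE CollectE exE conjE) (use below above \<open>l \<in> U\<close> in simp_all)
  qed (use l in \<open>simp only: smyth_topology_def topology_generated_by_topspace\<close>)
qed

text \<open>The Yoneda subbasis has only sets of the form \<open>> r\<close>, which gives lower semicontinuity of the
  distances in both arguments and nothing more.\<close>

lemma limitin_yoneda_topology:
  assumes "\<forall>\<^sub>F i in F. x i \<in> X"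
  shows "limitin (yoneda_topology X e) x l F \<longleftrightarrow>
    l \<in> X \<and> (\<forall>c\<in>X. e l c \<le> Liminf F (\<lambda>i. e (x i) c) \<and> e c l \<le> Liminf F (\<lambda>i. e c (x i)))"
    (is "?L \<longleftrightarrow> ?R")
proof
  assume L: ?L
  then have l: "l \<in> X"
    using limitin_topspace topspace_yoneda_topology by metis
  have ev: "\<forall>\<^sub>F i in F. x i \<in> U"
    if "l \<in> U" "U \<in> {{x\<in>X. enn2ereal (e x c) > ereal r} | c r. c \<in> X} \<union>
      {{x\<in>X. enn2ereal (e c x) > ereal r} | c r. c \<in> X}" for U
    using L[unfolded yoneda_topology_def limitin_topology_generated_by, THEN conjunct2, THEN bspec,
      OF that(2), THEN mp, OF that(1)] .
  have "e l c \<le> Liminf F (\<lambda>i. e (x i) c)" if c: "c \<in> X" for c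
    unfolding le_Liminf_iff
  proof safe
    fix a assume "a < e l c"
    then obtain r where r: "enn2ereal a < ereal r" "ereal r < enn2ereal (e l c)"
      using ereal_dense2 by (auto simp: less_ennreal.rep_eq)
    have "\<forall>\<^sub>F i in F. x i \<in> {x\<in>X. enn2ereal (e x c) > ereal r}"
      by (rule ev) (use l c r in auto)
    then show "\<forall>\<^sub>F i in F. a < e (x i) c"
      by (rule eventually_mono) (use r in \<open>auto simp: less_ennreal.rep_eq\<close>)
  qed
  moreover have "e c l \<le> Liminf F (\<lambda>i. e c (x i))" if c: "c \<in> X" for c
    unfolding le_Liminf_iff
  proof safe
    fix a assume "a < e c l"
    then obtain r where r: "enn2ereal a < ereal r" "ereal r < enn2ereal (e c l)"
      using ereal_dense2 by (auto simp: less_ennreal.rep_eq)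
    have "\<forall>\<^sub>F i in F. x i \<in> {x\<in>X. enn2ereal (e c x) > ereal r}"
      by (rule ev) (use l c r in auto)
    then show "\<forall>\<^sub>F i in F. a < e c (x i)"
      by (rule eventually_mono) (use r in \<open>auto simp: less_ennreal.rep_eq\<close>)
  qed
  ultimately show ?R using l by blast
next
  assume R: ?R
  have l: "l \<in> topspace (yoneda_topology X e)" using R by (simp add: topspace_yoneda_topology)
  have above: "\<forall>\<^sub>F i in F. x i \<in> {x\<in>X. enn2ereal (h x) > ereal r}"
    if "h l \<le> Liminf F (\<lambda>i. h (x i))" "enn2ereal (h l) > ereal r" for h r
  proof -
    have "\<forall>\<^sub>F i in F. r < 0 \<or> h (x i) > ennreal r"
    proof (cases "r < 0")
      case False
      then have "\<forall>\<^sub>F i in F. h (x i) > ennreal r"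
        using that by (auto simp: le_Liminf_iff ereal_less_enn2ereal_iff)
      then show ?thesis by (rule eventually_mono) simp
    qed simp
    with assms show ?thesis by eventually_elim (simp add: ereal_less_enn2ereal_iff)
  qed
  show ?L
    unfolding yoneda_topology_def limitin_topology_generated_by
  proof (intro conjI ballI impI)
    fix U
    assume U: "U \<in> {{x\<in>X. enn2ereal (e x c) > ereal r} | c r. c \<in> X} \<union>
      {{x\<in>X. enn2ereal (e c x) > ereal r} | c r. c \<in> X}" and "l \<in> U"
    from U show "\<forall>\<^sub>F i in F. x i \<in> U"
    proof (elim UnE CollectE exE conjE)
      fix c r assume "U = {x\<in>X. enn2ereal (e x c) > ereal r}" "c \<in> X"
      then show ?thesis using above[of "\<lambda>x. e x c" r] R \<open>l \<in> U\<close> by simp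
    next
      fix c r assume "U = {x\<in>X. enn2ereal (e c x) > ereal r}" "c \<in> X"
      then show ?thesis using above[of "e c" r] R \<open>l \<in> U\<close> by simp
    qed
  qed (use l in \<open>simp only: yoneda_topology_def topology_generated_by_topspace\<close>)
qed

section \<open>Cauchy nets\<close>

lemma net_filter_neq_bot:
  assumes "net_on X L R x"
  shows "net_filter L R \<noteq> bot"
  using assms unfolding trivial_limit_def eventually_net_filter[OF assms] net_on_def by metis

lemma eventually_net_in:
  assumes "net_on X L R x"
  shows "\<forall>\<^sub>F i in net_filter L R. x i \<in> X"
  using assms unfolding eventually_net_filter[OF assms] net_on_def by blast

text \<open>The supremum of each tail is a null family that bounds the tail distances. Everything later
  uses only this consequence of the Cauchy property, so that the order of the index set stays
  hidden behind the filter.\<close>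

lemma cauchy_net_tail_bound:
  assumes "net_on X L R x" and "cauchy_net d L R x"
  obtains s where "(s \<longlongrightarrow> 0) (net_filter L R)"
    and "\<forall>\<^sub>F i in net_filter L R. \<forall>\<^sub>F j in net_filter L R. d (x i) (x j) \<le> s i"
proof
  show "((\<lambda>i. SUP j\<in>{j\<in>L. R i j}. d (x i) (x j)) \<longlongrightarrow> 0) (net_filter L R)"
    using assms(2) by (simp add: cauchy_net_def)
  have "\<forall>\<^sub>F j in net_filter L R. d (x i) (x j) \<le> (SUP j\<in>{j\<in>L. R i j}. d (x i) (x j))"
    if "i \<in> L" for i
    unfolding eventually_net_filter[OF assms(1)] using that by (auto intro!: SUP_upper)
  moreover have "\<forall>\<^sub>F i in net_filter L R. i \<in> L"
    using assms(1) unfolding eventually_net_filter[OF assms(1)] net_on_def by blast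
  ultimately show "\<forall>\<^sub>F i in net_filter L R. \<forall>\<^sub>F j in net_filter L R.
      d (x i) (x j) \<le> (SUP j\<in>{j\<in>L. R i j}. d (x i) (x j))"
    by (auto elim: eventually_mono)
qed

lemma cauchy_net_mono:
  assumes net: "net_on X L R x" and cauchy: "cauchy_net d L R x"
    and le: "\<And>a b. a \<in> X \<Longrightarrow> b \<in> X \<Longrightarrow> e a b \<le> d a b"
  shows "cauchy_net e L R x"
  unfolding cauchy_net_def
proof (rule tendsto_sandwich[OF _ _ tendsto_const cauchy[unfolded cauchy_net_def]])
  show "\<forall>\<^sub>F i in net_filter L R.
      (SUP j\<in>{j\<in>L. R i j}. e (x i) (x j)) \<le> (SUP j\<in>{j\<in>L. R i j}. d (x i) (x j))"
    using eventually_net_in[OF net]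
  proof eventually_elim
    case (elim i)
    have "x j \<in> X" if "j \<in> L" for j using net that unfolding net_on_def by blast
    with elim show ?case by (intro SUP_mono) (auto intro: le)
  qed
qed simp

text \<open>The inequality \<open>g b \<le> g a + e a b\<close> says that \<open>g\<close> increases along the net by at most the tail
  bound, so its upper limit cannot exceed its lower limit. Besides \<open>g = e c\<close>, the case needed is
  \<open>g = d c\<close> for another distance \<open>d\<close>, along nets that are Cauchy for \<open>e\<close> only.\<close>

lemma cauchy_net_convergent:
  fixes g :: "'a \<Rightarrow> ennreal"
  assumes net: "net_on X L R x" and cauchy: "cauchy_net e L R x"
    and g: "\<And>a b. a \<in> X \<Longrightarrow> b \<in> X \<Longrightarrow> g b \<le> g a + e a b"
  shows "((\<lambda>i. g (x i)) \<longlongrightarrow> Liminf (net_filter L R) (\<lambda>i. g (x i))) (net_filter L R)"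
proof -
  let ?F = "net_filter L R"
  obtain s where s: "(s \<longlongrightarrow> 0) ?F" "\<forall>\<^sub>F i in ?F. \<forall>\<^sub>F j in ?F. e (x i) (x j) \<le> s i"
    using cauchy_net_tail_bound[OF net cauchy] .
  have "\<forall>\<^sub>F i in ?F. Limsup ?F (\<lambda>j. g (x j)) \<le> s i + g (x i)"
    using s(2) eventually_net_in[OF net]
  proof eventually_elim
    case (elim i)
    from elim(1) eventually_net_in[OF net] have "\<forall>\<^sub>F j in ?F. g (x j) \<le> s i + g (x i)"
    proof eventually_elim
      case (elim j)
      have "g (x j) \<le> g (x i) + e (x i) (x j)" using elim \<open>x i \<in> X\<close> by (intro g)
      also have "\<dots> \<le> g (x i) + s i" using elim by (intro add_left_mono)
      finally show ?case by (simp add: ac_simps)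
    qed
    then show ?case by (rule Limsup_bounded)
  qed
  then have "Limsup ?F (\<lambda>j. g (x j)) \<le> 0 + Liminf ?F (\<lambda>i. g (x i))"
    by (rule limit_le_add_Liminf[OF tendsto_const s(1)])
  then show ?thesis
    using Liminf_le_Limsup[OF net_filter_neq_bot[OF net], of "\<lambda>i. g (x i)"]
    by (simp add: tendsto_iff_Liminf_eq_Limsup net_filter_neq_bot[OF net])
qed

text \<open>Lower semicontinuity in the second argument bounds \<open>e (x i) l\<close> by the distances from \<open>x i\<close> to
  the later members of the net, which the Cauchy property makes small. The hypothesis is the common
  part of Smyth and Yoneda convergence.\<close>

lemma cauchy_net_dist_to_limit:
  assumes net: "net_on X L R x" and cauchy: "cauchy_net e L R x"
    and lim: "\<And>c. c \<in> X \<Longrightarrow> e c l \<le> Liminf (net_filter L R) (\<lambda>i. e c (x i))"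
  shows "((\<lambda>i. e (x i) l) \<longlongrightarrow> 0) (net_filter L R)"
proof -
  let ?F = "net_filter L R"
  obtain s where s: "(s \<longlongrightarrow> 0) ?F" "\<forall>\<^sub>F i in ?F. \<forall>\<^sub>F j in ?F. e (x i) (x j) \<le> s i"
    using cauchy_net_tail_bound[OF net cauchy] .
  have "\<forall>\<^sub>F i in ?F. e (x i) l \<le> s i"
    using s(2) eventually_net_in[OF net]
  proof eventually_elim
    case (elim i)
    have "e (x i) l \<le> Liminf ?F (\<lambda>j. e (x i) (x j))" using elim by (intro lim)
    also have "\<dots> \<le> Limsup ?F (\<lambda>j. e (x i) (x j))"
      by (rule Liminf_le_Limsup[OF net_filter_neq_bot[OF net]])
    also have "\<dots> \<le> s i" using elim(1) by (rule Limsup_bounded)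
    finally show ?case .
  qed
  then show ?thesis
    by (intro tendsto_sandwich[OF _ _ tendsto_const s(1)]) auto
qed

section \<open>Nets of formal balls\<close>

text \<open>Rational radii keep the set of formal balls small enough to be indexed by \<open>'i\<close>. A map of \<open>'i\<close>
  onto the balls is enough: repeated balls do no harm in a net.\<close>

lemma surj_onto_times_rat:
  fixes X :: "'a set"
  assumes "infinite (UNIV :: 'i set)" and "X \<lesssim> (UNIV :: 'i set)"
  obtains p :: "'i \<Rightarrow> 'a" and q :: "'i \<Rightarrow> rat" where "\<And>c r. c \<in> X \<Longrightarrow> \<exists>i. p i = c \<and> q i = r"
proof -
  have "(UNIV :: rat set) \<lesssim> (UNIV :: nat set)"
    using countable_rat unfolding countable_def lepoll_def by auto
  also have "\<dots> \<lesssim> (UNIV :: 'i set)" using assms(1) infinite_le_lepoll by blast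
  finally have "X \<times> (UNIV :: rat set) \<lesssim> (UNIV :: 'i set) \<times> (UNIV :: 'i set)"
    using assms(2) by (rule times_lepoll_mono[rotated])
  also have "\<dots> \<lesssim> (UNIV :: 'i set)"
    using card_of_Times_same_infinite[OF assms(1)] ordIso_imp_ordLeq card_of_ordLeq
    unfolding lepoll_def by blast
  finally obtain g :: "'i \<Rightarrow> 'a \<times> rat" where "X \<times> UNIV \<subseteq> range g"
    unfolding lepoll_iff by blast
  then have "\<exists>i. fst (g i) = c \<and> snd (g i) = r" if "c \<in> X" for c r
    using that by (metis SigmaI UNIV_I fst_conv rangeE snd_conv subsetD)
  then show thesis by (rule that[of "fst \<circ> g" "snd \<circ> g", unfolded comp_apply])
qed

text \<open>Here \<open>f c\<close> plays the role of the distance from \<open>c\<close> to an ideal point, and the balls with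
  \<open>f (p i) < q i\<close> are those that contain this point in their interior. The relation \<open>R\<close> says that
  the ball \<open>j\<close> lies strictly inside the ball \<open>i\<close>; strictness makes \<open>d (p i) (p j) < q i\<close>, so the net
  is Cauchy as soon as the radii tend to \<open>0\<close>. The distance from \<open>c\<close> is at most any radius above \<open>f c\<close>
  once the net has passed the ball around \<open>c\<close> with that radius.\<close>

lemma formal_ball_net:
  fixes f :: "'a \<Rightarrow> ennreal"
  assumes inf: "infinite (UNIV :: 'i set)" and card: "X \<lesssim> (UNIV :: 'i set)"
    and d: "distance_on X d" and ne: "X \<noteq> {}"
    and f_le: "\<And>c z. c \<in> X \<Longrightarrow> z \<in> X \<Longrightarrow> f c \<le> d c z + f z"
    and interp: "\<And>a b \<epsilon>. a \<in> X \<Longrightarrow> b \<in> X \<Longrightarrow> 0 < \<epsilon> \<Longrightarrow>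
      \<exists>w\<in>X. f w \<le> \<epsilon> \<and> d a w \<le> f a + \<epsilon> \<and> d b w \<le> f b + \<epsilon>"
  obtains L :: "'i set" and R y where "net_on X L R y" and "cauchy_net d L R y"
    and "\<And>c. c \<in> X \<Longrightarrow> ((\<lambda>i. d c (y i)) \<longlongrightarrow> f c) (net_filter L R)"
proof -
  obtain p :: "'i \<Rightarrow> 'a" and q' :: "'i \<Rightarrow> rat"
    where pq': "\<And>c r. c \<in> X \<Longrightarrow> \<exists>i. p i = c \<and> q' i = r"
    using surj_onto_times_rat[OF inf card] by metis
  define q where "q i = ennreal (of_rat (q' i))" for i
  have pq: "\<exists>i. p i = c \<and> a < q i \<and> q i < b" if c: "c \<in> X" and ab: "a < b" for c a b
  proof -
    obtain u where u: "a < u" "u < b" using dense[OF ab] by blast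
    then obtain u' where u': "u = ennreal u'" "0 \<le> u'" by (cases u) auto
    obtain v where v: "u < v" "v < b" using dense[OF u(2)] by blast
    then obtain v' where v': "v = ennreal v'" "0 \<le> v'" by (cases v) auto
    have "u' < v'" using v(1) u' v' by (simp add: ennreal_less_iff)
    then obtain r where r: "u' < of_rat r" "of_rat r < v'" using of_rat_dense by blast
    then have "u < ennreal (of_rat r)" "ennreal (of_rat r) < v"
      using u'(2) unfolding u'(1) v'(1) by (auto intro!: ennreal_lessI simp del: zero_less_of_rat_iff)
    moreover obtain i where "p i = c" "q' i = r" using pq'[OF c] by blast
    ultimately show ?thesis using u v unfolding q_def by (metis order.strict_trans)
  qed
  define L where "L = {i. p i \<in> X \<and> f (p i) < q i}"
  define R where "R i j \<longleftrightarrow> d (p i) (p j) + q j < q i" for i j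
  have R_less: "d (p i) (p j) < q i" "q j < q i" if "R i j" for i j
    using that unfolding R_def
    by (auto intro: le_less_trans[rotated])
  \<comment> \<open>Two balls leave room \<open>2\<delta>\<close> between \<open>f\<close> at the centre and the radius. One \<open>\<delta>\<close> pays for the
    interpolating centre, the other for the new radius; the same choice makes the radius small.\<close>
  have small: "\<exists>k\<in>L. R i k \<and> R j k \<and> q k < \<epsilon>" if ij: "i \<in> L" "j \<in> L" and \<epsilon>: "0 < \<epsilon>" for i j \<epsilon>
  proof -
    have gap: "\<exists>\<delta>>0. f (p i) + (\<delta> + \<delta>) < q i" if i: "i \<in> L" for i
    proof -
      obtain u where u: "f (p i) < u" "u < q i" using i dense unfolding L_def by blast
      then have "0 < u - f (p i)" by (simp add: diff_gt_0_iff_gt_ennreal)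
      then obtain \<delta> where \<delta>: "0 < \<delta>" "\<delta> + \<delta> \<le> u - f (p i)" by (rule ennreal_half_pos)
      have "f (p i) + (\<delta> + \<delta>) \<le> f (p i) + (u - f (p i))" using \<delta> by (intro add_left_mono)
      also have "\<dots> = u" using u by (intro add_diff_inverse_ennreal) simp
      finally show ?thesis using u(2) \<delta>(1) by (meson le_less_trans)
    qed
    obtain \<delta>i \<delta>j where \<delta>: "0 < \<delta>i" "f (p i) + (\<delta>i + \<delta>i) < q i"
        "0 < \<delta>j" "f (p j) + (\<delta>j + \<delta>j) < q j"
      using gap ij by metis
    define \<delta> where "\<delta> = min \<epsilon> (min \<delta>i \<delta>j)"
    have "0 < \<delta>" using \<delta> \<epsilon> by (simp add: \<delta>_def)
    then obtain \<eta> where \<eta>: "0 < \<eta>" "\<eta> < \<delta>" using dense by blast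
    obtain w where w: "w \<in> X" "f w \<le> \<eta>" "d (p i) w \<le> f (p i) + \<eta>" "d (p j) w \<le> f (p j) + \<eta>"
      using interp[of "p i" "p j" \<eta>] ij \<eta>(1) unfolding L_def by blast
    obtain k where k: "p k = w" "\<eta> < q k" "q k < \<delta>" using pq[OF w(1) \<eta>(2)] by blast
    have "k \<in> L" using w k unfolding L_def by auto
    moreover have "R a k"
      if "d (p a) w \<le> f (p a) + \<eta>" "\<delta> \<le> \<delta>a" "f (p a) + (\<delta>a + \<delta>a) < q a" for a \<delta>a
    proof -
      have "d (p a) (p k) + q k \<le> (f (p a) + \<eta>) + \<delta>"
        using that k by (intro add_mono) auto
      also have "\<dots> \<le> (f (p a) + \<delta>a) + \<delta>a"
        using that \<eta> by (intro add_mono) auto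
      also have "\<dots> < q a" using that by (simp add: add.assoc)
      finally show ?thesis unfolding R_def .
    qed
    then have "R i k" "R j k"
      using w(3,4) \<delta>(2,4) unfolding \<delta>_def by (meson min.cobounded1 min.cobounded2 order_trans)+
    moreover have "q k < \<epsilon>" using k unfolding \<delta>_def by simp
    ultimately show ?thesis by blast
  qed
  obtain i0 where i0: "i0 \<in> L"
  proof -
    obtain c where c: "c \<in> X" using ne by blast
    obtain w where w: "w \<in> X" "f w \<le> 1" using interp[OF c c, of 1] by auto
    obtain i where "p i = w" "1 < q i" using pq[OF w(1), of 1 2] by auto
    with w have "i \<in> L" unfolding L_def by auto
    then show thesis by (rule that)
  qed
  have net: "net_on X L R p"
    unfolding net_on_def
  proof (intro conjI ballI)
    show "L \<noteq> {}" using i0 by blast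
    show "transp_on L R"
    proof (rule transp_onI)
      fix i j k assume L: "i \<in> L" "j \<in> L" "k \<in> L" and ij: "R i j" and jk: "R j k"
      have "d (p i) (p k) + q k \<le> (d (p i) (p j) + d (p j) (p k)) + q k"
        using d L unfolding distance_on_def L_def by (intro add_right_mono) auto
      also have "\<dots> \<le> d (p i) (p j) + q j"
        using jk unfolding R_def by (simp add: add.assoc add_left_mono less_imp_le)
      also have "\<dots> < q i" using ij unfolding R_def .
      finally show "R i k" unfolding R_def .
    qed
    show "\<exists>k\<in>L. R i k \<and> R j k" if "i \<in> L" "j \<in> L" for i j
      using small[OF that, of 1] by auto
    show "p ` L \<subseteq> X" unfolding L_def by blast
  qed
  let ?F = "net_filter L R"
  have q_small: "\<forall>\<^sub>F i in ?F. i \<in> L \<and> q i < \<epsilon>" if "0 < \<epsilon>" for \<epsilon>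
    unfolding eventually_net_filter[OF net]
    using small[OF i0 i0 that] R_less(2) by (meson order.strict_trans)
  have q_lim: "(q \<longlongrightarrow> 0) ?F"
    by (rule order_tendstoI) (auto intro: eventually_mono[OF q_small])
  have "\<forall>\<^sub>F i in ?F. (SUP j\<in>{j\<in>L. R i j}. d (p i) (p j)) \<le> q i"
    by (intro always_eventually allI SUP_least) (auto dest: R_less(1) less_imp_le)
  then have cauchy: "cauchy_net d L R p"
    unfolding cauchy_net_def by (rule tendsto_sandwich[OF _ _ tendsto_const q_lim, rotated]) simp
  have "((\<lambda>i. d c (p i)) \<longlongrightarrow> f c) ?F" if c: "c \<in> X" for c
  proof -
    have "\<forall>\<^sub>F i in ?F. f c \<le> q i + d c (p i)"
      using q_small[of 1, simplified]
    proof eventually_elim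
      case (elim i)
      have "f c \<le> d c (p i) + f (p i)" using elim c unfolding L_def by (intro f_le) auto
      also have "\<dots> \<le> d c (p i) + q i" using elim unfolding L_def by (intro add_left_mono) auto
      finally show ?case by (simp add: ac_simps)
    qed
    then have low: "f c \<le> 0 + Liminf ?F (\<lambda>i. d c (p i))"
      by (rule limit_le_add_Liminf[OF tendsto_const q_lim])
    have up: "Limsup ?F (\<lambda>i. d c (p i)) \<le> f c"
    proof (rule dense_ge)
      fix a assume "f c < a"
      then obtain k where k: "p k = c" "f c < q k" "q k < a" using pq[OF c] by blast
      then have "k \<in> L" using c unfolding L_def by simp
      then have "\<forall>\<^sub>F i in ?F. d c (p i) \<le> a"
        unfolding eventually_net_filter[OF net] using k R_less(1)
        by (metis less_imp_le order.strict_trans)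
      then show "Limsup ?F (\<lambda>i. d c (p i)) \<le> a" by (rule Limsup_bounded)
    qed
    show ?thesis
      using low up Liminf_le_Limsup[OF net_filter_neq_bot[OF net], of "\<lambda>i. d c (p i)"]
      unfolding tendsto_iff_Liminf_eq_Limsup[OF net_filter_neq_bot[OF net]]
      by (metis add_0 antisym order_trans)
  qed
  with net cauchy show thesis by (rule that)
qed

section \<open>Hemimetrics and the way-below distance as best constants\<close>

lemma lower_hemimetric_le_iff:
  "lower_hemimetric X d z y \<le> c \<longleftrightarrow> (\<forall>x\<in>X. d x y \<le> d x z + c)"
  by (simp add: lower_hemimetric_def SUP_le_iff pos_diff_le_iff)

lemma lower_hemimetric_triangle:
  "b \<in> X \<Longrightarrow> d b y \<le> d b x + lower_hemimetric X d x y"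
  using lower_hemimetric_le_iff[of X d x y "lower_hemimetric X d x y"] by simp

lemma upper_hemimetric_le_iff:
  "upper_hemimetric X d x z \<le> c \<longleftrightarrow> (\<forall>y\<in>X. d x y \<le> d z y + c)"
  by (simp add: upper_hemimetric_def SUP_le_iff pos_diff_le_iff)

text \<open>Together with \<open>way_below_le\<close> this characterizes the way-below distance as a least constant, so
  that the truncated subtraction is not met again.\<close>

lemma Liminf_le_add_way_below:
  fixes L :: "'i set"
  assumes "z \<in> X" "net_on X L R w" "cauchy_net e L R w"
    "limitin (yoneda_topology X e) w z (net_filter L R)"
  shows "Liminf (net_filter L R) (\<lambda>l. e x (w l)) \<le> e y z + way_below TYPE('i) X e x y"
  unfolding pos_diff_le_iff[symmetric] way_below_def
  by (rule Sup_upper) (use assms in blast)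

lemma way_below_le:
  assumes "\<And>z (L :: 'i set) R w. z \<in> X \<Longrightarrow> net_on X L R w \<Longrightarrow> cauchy_net e L R w \<Longrightarrow>
    limitin (yoneda_topology X e) w z (net_filter L R) \<Longrightarrow>
    Liminf (net_filter L R) (\<lambda>l. e x (w l)) \<le> e y z + c"
  shows "way_below TYPE('i) X e x y \<le> c"
  unfolding way_below_def by (rule Sup_least) (auto simp: pos_diff_le_iff assms)

section \<open>From Yoneda to Smyth\<close>

lemma way_below_triangle_right:
  fixes X :: "'a set"
  assumes e: "distance_on X e" and "y \<in> X" "y' \<in> X"
  shows "way_below TYPE('i) X e x y' \<le> way_below TYPE('i) X e x y + e y y'"
proof (rule way_below_le)
  fix z and L :: "'i set" and R w
  assume zw: "z \<in> X" "net_on X L R w" "cauchy_net e L R w"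
    "limitin (yoneda_topology X e) w z (net_filter L R)"
  have "Liminf (net_filter L R) (\<lambda>l. e x (w l)) \<le> e y z + way_below TYPE('i) X e x y"
    using zw by (rule Liminf_le_add_way_below)
  also have "\<dots> \<le> (e y y' + e y' z) + way_below TYPE('i) X e x y"
    using e assms zw(1) unfolding distance_on_def by (intro add_right_mono) auto
  finally show "Liminf (net_filter L R) (\<lambda>l. e x (w l)) \<le>
      e y' z + (way_below TYPE('i) X e x y + e y y')"
    by (simp add: ac_simps)
qed

lemma way_below_triangle_left:
  fixes X :: "'a set"
  assumes e: "distance_on X e" and "x \<in> X" "x' \<in> X"
  shows "way_below TYPE('i) X e x y \<le> e x x' + way_below TYPE('i) X e x' y"
proof (rule way_below_le)
  fix z and L :: "'i set" and R w
  assume zw: "z \<in> X" "net_on X L R w" "cauchy_net e L R w"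
    "limitin (yoneda_topology X e) w z (net_filter L R)"
  let ?F = "net_filter L R"
  have conv: "((\<lambda>i. e a (w i)) \<longlongrightarrow> Liminf ?F (\<lambda>i. e a (w i))) ?F" if "a \<in> X" for a
    by (rule cauchy_net_convergent[OF zw(2,3)]) (use e that in \<open>auto simp: distance_on_def\<close>)
  have "Liminf ?F (\<lambda>l. e x (w l)) \<le> e x x' + Liminf ?F (\<lambda>l. e x' (w l))"
    by (rule limit_le_add_Liminf[OF conv tendsto_const])
       (use e assms eventually_net_in[OF zw(2)] in \<open>auto simp: distance_on_def elim: eventually_mono\<close>)
  also have "\<dots> \<le> e x x' + (e y z + way_below TYPE('i) X e x' y)"
    using zw by (intro add_left_mono Liminf_le_add_way_below)
  finally show "Liminf ?F (\<lambda>l. e x (w l)) \<le> e y z + (e x x' + way_below TYPE('i) X e x' y)"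
    by (simp add: ac_simps)
qed

text \<open>The constant net at \<open>y\<close> is a competitor in the supremum; it is Cauchy because \<open>e y y = 0\<close>.\<close>

lemma le_way_below:
  assumes e: "distance_on X e" and "x \<in> X" "y \<in> X" "e y y = 0"
  shows "e x y \<le> way_below TYPE('i) X e x y"
proof -
  let ?L = "{undefined :: 'i}" and ?R = "\<lambda>_ _ :: 'i. True"
  have net: "net_on X ?L ?R (\<lambda>_. y)"
    using assms by (auto simp: net_on_def transp_on_def)
  have "cauchy_net e ?L ?R (\<lambda>_. y)"
    using assms by (simp add: cauchy_net_def)
  then have "Liminf (net_filter ?L ?R) (\<lambda>l. e x y) \<le> e y y + way_below TYPE('i) X e x y"
    using assms net by (intro Liminf_le_add_way_below) (auto simp: topspace_yoneda_topology)
  then show ?thesis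
    using assms by (simp add: Liminf_const net_filter_neq_bot[OF net])
qed

text \<open>Half of the convergence of \<open>d c (x i)\<close> to \<open>d c l\<close> comes from \<open>e (x i) l\<close> tending to \<open>0\<close>. The
  other half holds because the net is itself one of the nets in the supremum that defines
  \<open>d c l\<close>, with \<open>e l l = 0\<close> subtracted.\<close>

lemma smyth_limit_of_yoneda_limit:
  fixes X :: "'a set" and L :: "'i set"
  assumes dd: "distance_on X d" and e: "distance_on X e"
    and wb: "\<And>x y. x \<in> X \<Longrightarrow> y \<in> X \<Longrightarrow> d x y = way_below TYPE('i) X e x y"
    and e0: "\<And>x. x \<in> X \<Longrightarrow> e x x = 0"
    and net: "net_on X L R x" and cauchy: "cauchy_net d L R x"
    and lim: "limitin (yoneda_topology X e) x l (net_filter L R)"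
  shows "limitin (smyth_topology X d) x l (net_filter L R)"
proof -
  let ?F = "net_filter L R"
  note inX = eventually_net_in[OF net]
  have l: "l \<in> X" and lims: "\<And>c. c \<in> X \<Longrightarrow> e c l \<le> Liminf ?F (\<lambda>i. e c (x i))"
    using lim unfolding limitin_yoneda_topology[OF inX] by auto
  have e_le: "e a b \<le> d a b" if "a \<in> X" "b \<in> X" for a b
    using le_way_below[OF e that e0] that by (simp add: wb)
  have cauchy_e: "cauchy_net e L R x"
    by (rule cauchy_net_mono[OF net cauchy e_le])
  have el: "((\<lambda>i. e (x i) l) \<longlongrightarrow> 0) ?F"
    by (rule cauchy_net_dist_to_limit[OF net cauchy_e lims])
  have "((\<lambda>i. d c (x i)) \<longlongrightarrow> d c l) ?F" if c: "c \<in> X" for c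
  proof -
    have conv: "((\<lambda>i. d c (x i)) \<longlongrightarrow> Liminf ?F (\<lambda>i. d c (x i))) ?F"
      by (rule cauchy_net_convergent[OF net cauchy]) (use dd c in \<open>auto simp: distance_on_def\<close>)
    have "d c l \<le> 0 + Liminf ?F (\<lambda>i. d c (x i))"
      by (rule limit_le_add_Liminf[OF tendsto_const el], rule eventually_mono[OF inX])
         (use way_below_triangle_right[OF e _ l, of _ c] c l in \<open>simp add: wb add.commute\<close>)
    moreover have "Liminf ?F (\<lambda>i. d c (x i)) \<le> d c l"
    proof -
      obtain s where s: "(s \<longlongrightarrow> 0) ?F" "\<forall>\<^sub>F i in ?F. \<forall>\<^sub>F j in ?F. d (x i) (x j) \<le> s i"
        using cauchy_net_tail_bound[OF net cauchy] .
      have "\<forall>\<^sub>F i in ?F. Liminf ?F (\<lambda>j. d c (x j)) \<le> s i + e c (x i)"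
        using s(2) inX
      proof eventually_elim
        case (elim i)
        from elim(1) inX have "\<forall>\<^sub>F j in ?F. d c (x j) \<le> s i + e c (x i)"
        proof eventually_elim
          case (elim j)
          have "d c (x j) \<le> e c (x i) + d (x i) (x j)"
            using way_below_triangle_left[OF e c \<open>x i \<in> X\<close>, of "x j"] c elim \<open>x i \<in> X\<close>
            by (simp add: wb)
          also have "\<dots> \<le> e c (x i) + s i" using elim by (intro add_left_mono)
          finally show ?case by (simp add: ac_simps)
        qed
        then show ?case using conv net_filter_neq_bot[OF net]
          by (metis tendsto_upperbound)
      qed
      \<comment> \<open>The bound by \<open>e c (x i)\<close> lets the net be compared with itself in the way-below distance.\<close>
      then have "Liminf ?F (\<lambda>j. d c (x j)) \<le> 0 + Liminf ?F (\<lambda>i. e c (x i))"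
        by (rule limit_le_add_Liminf[OF tendsto_const s(1)])
      also have "\<dots> \<le> e l l + d c l"
        using Liminf_le_add_way_below[OF l net cauchy_e lim, of c l] c l e0 by (simp add: wb)
      finally show ?thesis using l e0 by simp
    qed
    ultimately show ?thesis using conv by simp
  qed
  with l show ?thesis by (simp add: limitin_smyth_topology[OF inX])
qed

lemma yoneda_imp_smyth:
  fixes X :: "'a set" and d e :: "'a \<Rightarrow> 'a \<Rightarrow> ennreal"
  assumes dd: "distance_on X d" and e: "distance_on X e"
    and complete: "net_complete TYPE('i) X e (yoneda_topology X e)"
    and continuous: "net_continuous TYPE('i) X d (yoneda_topology X e)"
    and wb: "\<And>x y. x \<in> X \<Longrightarrow> y \<in> X \<Longrightarrow> d x y = way_below TYPE('i) X e x y"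
    and e0: "\<And>x. x \<in> X \<Longrightarrow> e x x = 0"
  shows "net_complete TYPE('i) X d (smyth_topology X d)"
    and "net_continuous TYPE('i) X d (smyth_topology X d)"
    and "\<And>x y. x \<in> X \<Longrightarrow> y \<in> X \<Longrightarrow> e x y = lower_hemimetric X d x y"
    and "\<And>x y. x \<in> X \<Longrightarrow> y \<in> X \<Longrightarrow> upper_hemimetric X d x y \<le> e x y"
proof -
  have e_le: "e a b \<le> d a b" if "a \<in> X" "b \<in> X" for a b
    using le_way_below[OF e that e0] that by (simp add: wb)
  note smyth = smyth_limit_of_yoneda_limit[OF dd e wb e0]
  show "net_complete TYPE('i) X d (smyth_topology X d)"
    unfolding net_complete_def
  proof (intro allI impI, elim conjE)
    fix L :: "'i set" and R x
    assume net: "net_on X L R x" and cauchy: "cauchy_net d L R x"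
    have "cauchy_net e L R x" by (rule cauchy_net_mono[OF net cauchy e_le])
    with net complete obtain l where "l \<in> X" "limitin (yoneda_topology X e) x l (net_filter L R)"
      unfolding net_complete_def by blast
    with smyth[OF _ _ _ net cauchy]
    show "\<exists>l\<in>X. limitin (smyth_topology X d) x l (net_filter L R)" by blast
  qed
  show "net_continuous TYPE('i) X d (smyth_topology X d)"
    using continuous smyth unfolding net_continuous_def by meson
  show "upper_hemimetric X d x y \<le> e x y" if "x \<in> X" "y \<in> X" for x y
    using way_below_triangle_left[OF e that] that
    by (auto simp: upper_hemimetric_le_iff wb add.commute)
  show "e x y = lower_hemimetric X d x y" if xy: "x \<in> X" "y \<in> X" for x y
  proof (rule antisym)
    show "lower_hemimetric X d x y \<le> e x y"
      using way_below_triangle_right[OF e xy] xy by (auto simp: lower_hemimetric_le_iff wb)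
    obtain L :: "'i set" and R u where u: "net_on X L R u" "cauchy_net d L R u"
        "limitin (yoneda_topology X e) u x (net_filter L R)"
      using continuous xy(1) unfolding net_continuous_def by blast
    let ?F = "net_filter L R"
    note inX = eventually_net_in[OF u(1)]
    have "limitin (smyth_topology X d) u x ?F" using u by (intro smyth)
    then have d_lim: "((\<lambda>i. d c (u i)) \<longlongrightarrow> d c x) ?F" if "c \<in> X" for c
      using that by (simp add: limitin_smyth_topology[OF inX])
    have du: "((\<lambda>i. d (u i) x) \<longlongrightarrow> 0) ?F"
      by (rule cauchy_net_dist_to_limit[OF u(1,2)])
         (use d_lim lim_imp_Liminf[OF net_filter_neq_bot[OF u(1)]] in \<open>metis order_refl\<close>)
    \<comment> \<open>If \<open>d x x = 0\<close>, the point \<open>x\<close> tests the lower hemimetric directly; in general the points \<open>u i\<close>,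
      whose \<open>d\<close>-distance to \<open>x\<close> tends to \<open>0\<close>, take its place.\<close>
    have "e x y \<le> Liminf ?F (\<lambda>i. e (u i) y)"
      using u(3) xy unfolding limitin_yoneda_topology[OF inX] by blast
    also have "\<dots> \<le> Liminf ?F (\<lambda>i. d (u i) x + lower_hemimetric X d x y)"
    proof (rule Liminf_mono, rule eventually_mono[OF inX])
      fix i assume "u i \<in> X"
      then have "e (u i) y \<le> d (u i) y" using xy by (intro e_le)
      also have "\<dots> \<le> d (u i) x + lower_hemimetric X d x y"
        using \<open>u i \<in> X\<close> by (rule lower_hemimetric_triangle)
      finally show "e (u i) y \<le> d (u i) x + lower_hemimetric X d x y" .
    qed
    also have "\<dots> = 0 + lower_hemimetric X d x y"
      by (intro lim_imp_Liminf[OF net_filter_neq_bot[OF u(1)]] tendsto_add du tendsto_const)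
    finally show "e x y \<le> lower_hemimetric X d x y" by simp
  qed
qed

section \<open>From Smyth to Yoneda\<close>

text \<open>The lower hemimetric is the least \<open>e\<close> with \<open>d b y \<le> d b x + e x y\<close>. To bound \<open>e l c\<close> or \<open>e c l\<close> by a
  lower limit it is therefore enough to pass this inequality to the limit in the terms \<open>d b (x i)\<close>.\<close>

lemma yoneda_limit_of_pointwise_limit:
  assumes lower: "\<And>x y. x \<in> X \<Longrightarrow> y \<in> X \<Longrightarrow> e x y = lower_hemimetric X d x y"
    and inX: "\<forall>\<^sub>F i in F. x i \<in> X" and l: "l \<in> X"
    and lim: "\<And>c. c \<in> X \<Longrightarrow> ((\<lambda>i. d c (x i)) \<longlongrightarrow> d c l) F"
  shows "limitin (yoneda_topology X e) x l F"
  unfolding limitin_yoneda_topology[OF inX]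
proof (intro conjI ballI l)
  have tri: "d b y \<le> d b x + e x y" if "b \<in> X" "x \<in> X" "y \<in> X" for b x y
    using lower_hemimetric_triangle[OF that(1)] that by (simp add: lower)
  fix c assume c: "c \<in> X"
  have "d b c \<le> d b l + Liminf F (\<lambda>i. e (x i) c)" if b: "b \<in> X" for b
    by (rule limit_le_add_Liminf[OF tendsto_const lim[OF b]], rule eventually_mono[OF inX])
       (rule tri[OF b _ c])
  then show "e l c \<le> Liminf F (\<lambda>i. e (x i) c)"
    using l c by (simp add: lower lower_hemimetric_le_iff)
  have "d b l \<le> d b c + Liminf F (\<lambda>i. e c (x i))" if b: "b \<in> X" for b
    by (rule limit_le_add_Liminf[OF lim[OF b] tendsto_const], rule eventually_mono[OF inX])
       (rule tri[OF b c])
  then show "e c l \<le> Liminf F (\<lambda>i. e c (x i))"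
    using l c by (simp add: lower lower_hemimetric_le_iff)
qed

text \<open>A point \<open>x i\<close> far along the net has \<open>d a (x i)\<close> close to \<open>f a\<close>, but \<open>f (x i)\<close> need not be small,
  because the \<open>d\<close>-distances between members of an \<open>e\<close>-Cauchy net need not be. So \<open>x i\<close> is replaced by
  a member \<open>w\<close> of a \<open>d\<close>-Cauchy net that converges to it: \<open>d w (x i)\<close> is small, and stays so when
  \<open>e (x i) (x j)\<close> is added, while \<open>d a w\<close> is still close to \<open>d a (x i)\<close>.\<close>

lemma interpolation:
  assumes tri: "\<And>b x y. b \<in> X \<Longrightarrow> x \<in> X \<Longrightarrow> y \<in> X \<Longrightarrow> d b y \<le> d b x + e x y"
    and continuous: "net_continuous TYPE('i) X d (smyth_topology X d)"
    and net: "net_on X L R x" and cauchy: "cauchy_net e L R x"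
    and lim: "\<And>c. c \<in> X \<Longrightarrow> ((\<lambda>i. d c (x i)) \<longlongrightarrow> f c) (net_filter L R)"
    and ab: "a \<in> X" "b \<in> X" and \<epsilon>: "0 < \<epsilon>"
  shows "\<exists>w\<in>X. f w \<le> \<epsilon> \<and> d a w \<le> f a + \<epsilon> \<and> d b w \<le> f b + \<epsilon>"
proof -
  let ?F = "net_filter L R"
  obtain \<eta> where \<eta>: "0 < \<eta>" "\<eta> + \<eta> \<le> \<epsilon>" using ennreal_half_pos[OF \<epsilon>] .
  obtain s where s: "(s \<longlongrightarrow> 0) ?F" "\<forall>\<^sub>F i in ?F. \<forall>\<^sub>F j in ?F. e (x i) (x j) \<le> s i"
    using cauchy_net_tail_bound[OF net cauchy] .
  have "\<forall>\<^sub>F i in ?F. (s i \<le> 0 + \<eta> \<and> (\<forall>\<^sub>F j in ?F. e (x i) (x j) \<le> s i)) \<and> x i \<in> X \<and>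
      d a (x i) \<le> f a + \<eta> \<and> d b (x i) \<le> f b + \<eta>"
    using eventually_net_in[OF net] s ab \<eta>(1) lim
    by (intro eventually_conj eventually_le_add_of_tendsto) auto
  then obtain i where i: "s i \<le> \<eta>" "\<forall>\<^sub>F j in ?F. e (x i) (x j) \<le> s i" "x i \<in> X"
      "d a (x i) \<le> f a + \<eta>" "d b (x i) \<le> f b + \<eta>"
    using eventually_happens'[OF net_filter_neq_bot[OF net]] by force
  obtain M :: "'i set" and S w where w: "net_on X M S w" "cauchy_net d M S w"
      "limitin (smyth_topology X d) w (x i) (net_filter M S)"
    using continuous i(3) unfolding net_continuous_def by blast
  let ?G = "net_filter M S"
  have w_lim: "((\<lambda>k. d c (w k)) \<longlongrightarrow> d c (x i)) ?G" if "c \<in> X" for c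
    using w(3) that by (simp add: limitin_smyth_topology[OF eventually_net_in[OF w(1)]])
  have "((\<lambda>k. d (w k) (x i)) \<longlongrightarrow> 0) ?G"
    by (rule cauchy_net_dist_to_limit[OF w(1,2)])
       (use w_lim lim_imp_Liminf[OF net_filter_neq_bot[OF w(1)]] in \<open>metis order_refl\<close>)
  then have "\<forall>\<^sub>F k in ?G. d (w k) (x i) \<le> 0 + \<eta> \<and> w k \<in> X \<and>
      d a (w k) \<le> d a (x i) + \<eta> \<and> d b (w k) \<le> d b (x i) + \<eta>"
    using eventually_net_in[OF w(1)] ab \<eta>(1) w_lim
    by (intro eventually_conj eventually_le_add_of_tendsto) auto
  then obtain k where k: "d (w k) (x i) \<le> \<eta>" "w k \<in> X"
      "d a (w k) \<le> d a (x i) + \<eta>" "d b (w k) \<le> d b (x i) + \<eta>"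
    using eventually_happens'[OF net_filter_neq_bot[OF w(1)]] by force
  have "\<forall>\<^sub>F j in ?F. d (w k) (x j) \<le> \<epsilon>"
    using i(2) eventually_net_in[OF net]
  proof eventually_elim
    case (elim j)
    have "d (w k) (x j) \<le> d (w k) (x i) + e (x i) (x j)" using k i elim by (intro tri)
    also have "\<dots> \<le> \<eta> + \<eta>" using k i elim by (intro add_mono) auto
    finally show ?case using \<eta> by simp
  qed
  then have "f (w k) \<le> \<epsilon>"
    using lim[OF k(2)] net_filter_neq_bot[OF net] by (metis tendsto_upperbound)
  moreover have "d c (w k) \<le> f c + \<epsilon>"
    if "d c (w k) \<le> d c (x i) + \<eta>" "d c (x i) \<le> f c + \<eta>" for c
  proof -
    have "d c (w k) \<le> (f c + \<eta>) + \<eta>" using that by (meson add_right_mono order_trans)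
    also have "\<dots> \<le> f c + \<epsilon>" using \<eta>(2) by (simp add: add.assoc add_left_mono)
    finally show ?thesis .
  qed
  ultimately show ?thesis using k i by blast
qed

text \<open>Completeness concerns \<open>d\<close>-Cauchy nets, and \<open>x\<close> is only \<open>e\<close>-Cauchy; it is applied to the net of
  formal balls that has the same limits of distances.\<close>

lemma smyth_complete_cauchy_limit:
  fixes X :: "'a set" and d e :: "'a \<Rightarrow> 'a \<Rightarrow> ennreal" and L :: "'j set"
  assumes inf: "infinite (UNIV :: 'i set)" and card: "X \<lesssim> (UNIV :: 'i set)"
    and dd: "distance_on X d"
    and tri: "\<And>b x y. b \<in> X \<Longrightarrow> x \<in> X \<Longrightarrow> y \<in> X \<Longrightarrow> d b y \<le> d b x + e x y"
    and complete: "net_complete TYPE('i) X d (smyth_topology X d)"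
    and continuous: "net_continuous TYPE('i) X d (smyth_topology X d)"
    and net: "net_on X L R x" and cauchy: "cauchy_net e L R x"
  obtains l where "l \<in> X" "\<And>c. c \<in> X \<Longrightarrow> ((\<lambda>i. d c (x i)) \<longlongrightarrow> d c l) (net_filter L R)"
proof -
  let ?F = "net_filter L R"
  define f where "f c = Liminf ?F (\<lambda>i. d c (x i))" for c
  have lim: "((\<lambda>i. d c (x i)) \<longlongrightarrow> f c) ?F" if "c \<in> X" for c
    unfolding f_def by (rule cauchy_net_convergent[OF net cauchy]) (rule tri[OF that])
  have f_le: "f c \<le> d c z + f z" if "c \<in> X" "z \<in> X" for c z
    unfolding f_def[of z]
    by (rule limit_le_add_Liminf[OF lim tendsto_const])
       (use dd that eventually_net_in[OF net] in \<open>auto simp: distance_on_def elim: eventually_mono\<close>)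
  have ne: "X \<noteq> {}" using net unfolding net_on_def by blast
  obtain M :: "'i set" and S y where y: "net_on X M S y" "cauchy_net d M S y"
      "\<And>c. c \<in> X \<Longrightarrow> ((\<lambda>i. d c (y i)) \<longlongrightarrow> f c) (net_filter M S)"
    using formal_ball_net[OF inf card dd ne f_le interpolation[OF tri continuous net cauchy lim]]
    by blast
  obtain l where l: "l \<in> X" "limitin (smyth_topology X d) y l (net_filter M S)"
    using complete y unfolding net_complete_def by blast
  have "f c = d c l" if "c \<in> X" for c
  proof -
    have "((\<lambda>i. d c (y i)) \<longlongrightarrow> d c l) (net_filter M S)"
      using l(2) that by (simp add: limitin_smyth_topology[OF eventually_net_in[OF y(1)]])
    with net_filter_neq_bot[OF y(1)] y(3)[OF that] show ?thesis by (rule tendsto_unique)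
  qed
  with lim l(1) show thesis by (intro that[of l]) auto
qed

lemma smyth_imp_yoneda:
  fixes X :: "'a set" and d e :: "'a \<Rightarrow> 'a \<Rightarrow> ennreal"
  assumes inf: "infinite (UNIV :: 'i set)" and card: "X \<lesssim> (UNIV :: 'i set)"
    and dd: "distance_on X d"
    and complete: "net_complete TYPE('i) X d (smyth_topology X d)"
    and continuous: "net_continuous TYPE('i) X d (smyth_topology X d)"
    and lower: "\<And>x y. x \<in> X \<Longrightarrow> y \<in> X \<Longrightarrow> e x y = lower_hemimetric X d x y"
    and upper: "\<And>x y. x \<in> X \<Longrightarrow> y \<in> X \<Longrightarrow> upper_hemimetric X d x y \<le> e x y"
  shows "net_complete TYPE('i) X e (yoneda_topology X e)"
    and "net_continuous TYPE('i) X d (yoneda_topology X e)"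
    and "\<And>x y. x \<in> X \<Longrightarrow> y \<in> X \<Longrightarrow> d x y = way_below TYPE('i) X e x y"
proof -
  have tri: "d b y \<le> d b x + e x y" if "b \<in> X" "x \<in> X" "y \<in> X" for b x y
    using lower_hemimetric_triangle[OF that(1)] that by (simp add: lower)
  have tri': "d x b \<le> e x y + d y b" if "b \<in> X" "x \<in> X" "y \<in> X" for b x y
    using upper_hemimetric_le_iff[of X d x y "e x y"] upper that by (simp add: add.commute)
  have e_le: "e x y \<le> d x y" if "x \<in> X" "y \<in> X" for x y
    using dd that by (auto simp: lower lower_hemimetric_le_iff distance_on_def)
  note limit = smyth_complete_cauchy_limit[OF inf card dd tri complete continuous]
  note yoneda = yoneda_limit_of_pointwise_limit[of X e d, OF lower]
  show "net_complete TYPE('i) X e (yoneda_topology X e)"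
    unfolding net_complete_def
  proof (intro allI impI, elim conjE)
    fix L :: "'i set" and R x
    assume net: "net_on X L R x" and cauchy: "cauchy_net e L R x"
    obtain l where "l \<in> X" "\<And>c. c \<in> X \<Longrightarrow> ((\<lambda>i. d c (x i)) \<longlongrightarrow> d c l) (net_filter L R)"
      using limit[OF _ _ _ net cauchy] by blast
    with yoneda[OF _ _ eventually_net_in[OF net]]
    show "\<exists>l\<in>X. limitin (yoneda_topology X e) x l (net_filter L R)" by blast
  qed
  show "net_continuous TYPE('i) X d (yoneda_topology X e)"
    unfolding net_continuous_def
  proof
    fix l assume l: "l \<in> X"
    then obtain L :: "'i set" and R x where x: "net_on X L R x" "cauchy_net d L R x"
        "limitin (smyth_topology X d) x l (net_filter L R)"
      using continuous unfolding net_continuous_def by blast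
    note inX = eventually_net_in[OF x(1)]
    have "limitin (yoneda_topology X e) x l (net_filter L R)"
      using x(3) by (intro yoneda inX l) (auto simp: limitin_smyth_topology[OF inX])
    with x show "\<exists>(L :: 'i set) R x. net_on X L R x \<and> cauchy_net d L R x \<and>
        limitin (yoneda_topology X e) x l (net_filter L R)"
      by blast
  qed
  show "d x y = way_below TYPE('i) X e x y" if xy: "x \<in> X" "y \<in> X" for x y
  proof (rule antisym)
    obtain L :: "'i set" and R w where w: "net_on X L R w" "cauchy_net d L R w"
        "limitin (smyth_topology X d) w y (net_filter L R)"
      using continuous xy unfolding net_continuous_def by blast
    let ?F = "net_filter L R"
    note inX = eventually_net_in[OF w(1)]
    have w_lim: "((\<lambda>i. d c (w i)) \<longlongrightarrow> d c y) ?F" if "c \<in> X" for c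
      using w(3) that by (simp add: limitin_smyth_topology[OF inX])
    have "((\<lambda>i. d (w i) y) \<longlongrightarrow> 0) ?F"
      by (rule cauchy_net_dist_to_limit[OF w(1,2)])
         (use w_lim lim_imp_Liminf[OF net_filter_neq_bot[OF w(1)]] in \<open>metis order_refl\<close>)
    then have "d x y \<le> 0 + Liminf ?F (\<lambda>i. e x (w i))"
      by (rule limit_le_add_Liminf[OF tendsto_const], intro eventually_mono[OF inX])
         (use tri' xy in \<open>simp add: add.commute\<close>)
    also have "Liminf ?F (\<lambda>i. e x (w i)) \<le> e y y + way_below TYPE('i) X e x y"
      by (rule Liminf_le_add_way_below[OF xy(2) w(1)])
         (auto intro: cauchy_net_mono[OF w(1,2)] e_le yoneda inX xy w_lim)
    finally show "d x y \<le> way_below TYPE('i) X e x y"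
      using xy by (simp add: lower lower_hemimetric_self)
  next
    show "way_below TYPE('i) X e x y \<le> d x y"
    proof (rule way_below_le)
      fix z and L :: "'i set" and R w
      assume z: "z \<in> X" and w: "net_on X L R w" "cauchy_net e L R w"
        "limitin (yoneda_topology X e) w z (net_filter L R)"
      let ?F = "net_filter L R"
      note inX = eventually_net_in[OF w(1)]
      \<comment> \<open>The given \<open>z\<close> is a Yoneda limit only; \<open>z'\<close> has the right \<open>d\<close>-distances and \<open>e z z' = 0\<close>.\<close>
      obtain z' where z': "z' \<in> X" "\<And>c. c \<in> X \<Longrightarrow> ((\<lambda>i. d c (w i)) \<longlongrightarrow> d c z') ?F"
        using limit[OF _ _ _ w(1,2)] by blast
      have "limitin (yoneda_topology X e) w z' ?F" using z' by (intro yoneda inX)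
      then have "((\<lambda>i. e (w i) z') \<longlongrightarrow> 0) ?F"
        by (intro cauchy_net_dist_to_limit[OF w(1,2)]) (auto simp: limitin_yoneda_topology[OF inX])
      then have "Liminf ?F (\<lambda>i. e (w i) z') = 0"
        by (rule lim_imp_Liminf[OF net_filter_neq_bot[OF w(1)]])
      moreover have "e z z' \<le> Liminf ?F (\<lambda>i. e (w i) z')"
        using w(3) z' by (simp add: limitin_yoneda_topology[OF inX])
      ultimately have ezz': "e z z' = 0" by simp
      have "Liminf ?F (\<lambda>i. e x (w i)) \<le> Liminf ?F (\<lambda>i. d x (w i))"
        by (intro Liminf_mono eventually_mono[OF inX] e_le xy)
      also have "\<dots> = d x z'"
        by (rule lim_imp_Liminf[OF net_filter_neq_bot[OF w(1)] z'(2)[OF xy(1)]])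
      also have "\<dots> \<le> d x z + e z z'" using xy z z' by (intro tri)
      also have "\<dots> \<le> d x y + e y z" using tri[OF xy z] ezz' by simp
      finally show "Liminf ?F (\<lambda>i. e x (w i)) \<le> e y z + d x y" by (simp add: add.commute)
    qed
  qed
qed

theorem theorem3p4:
  fixes X :: "'a set" and d e :: "'a \<Rightarrow> 'a \<Rightarrow> ennreal"
  assumes "distance_on X d" and "distance_on X e"
    and "infinite (UNIV :: 'i set)" and "X \<lesssim> (UNIV :: 'i set)"
  shows "((net_complete TYPE('i) X e (yoneda_topology X e) \<and>
           net_continuous TYPE('i) X d (yoneda_topology X e) \<and>
           (\<forall>x\<in>X. \<forall>y\<in>X. d x y = way_below TYPE('i) X e x y)) \<and>
          (\<forall>x\<in>X. e x x = 0))
     \<longleftrightarrow> (net_complete TYPE('i) X d (smyth_topology X d) \<and>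
           net_continuous TYPE('i) X d (smyth_topology X d) \<and>
           (\<forall>x\<in>X. \<forall>y\<in>X. e x y = lower_hemimetric X d x y \<and>
                           lower_hemimetric X d x y \<ge> upper_hemimetric X d x y))"
  (is "?yoneda \<longleftrightarrow> ?smyth")
proof
  assume y: ?yoneda
  then have wb: "\<And>x y. x \<in> X \<Longrightarrow> y \<in> X \<Longrightarrow> d x y = way_below TYPE('i) X e x y"
    and e0: "\<And>x. x \<in> X \<Longrightarrow> e x x = 0" by blast+
  note smyth = yoneda_imp_smyth[where 'i = 'i, OF assms(1,2) _ _ wb e0]
  have "e x y = lower_hemimetric X d x y \<and> lower_hemimetric X d x y \<ge> upper_hemimetric X d x y"
    if "x \<in> X" "y \<in> X" for x y
  proof
    show eq: "e x y = lower_hemimetric X d x y" using y that by (intro smyth(3)) auto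
    have "upper_hemimetric X d x y \<le> e x y" using y that by (intro smyth(4)) auto
    then show "upper_hemimetric X d x y \<le> lower_hemimetric X d x y" by (simp only: eq)
  qed
  moreover have "net_complete TYPE('i) X d (smyth_topology X d)" using y by (intro smyth(1)) auto
  moreover have "net_continuous TYPE('i) X d (smyth_topology X d)" using y by (intro smyth(2)) auto
  ultimately show ?smyth by blast
next
  assume s: ?smyth
  then have lower: "\<And>x y. x \<in> X \<Longrightarrow> y \<in> X \<Longrightarrow> e x y = lower_hemimetric X d x y"
    and upper: "\<And>x y. x \<in> X \<Longrightarrow> y \<in> X \<Longrightarrow> upper_hemimetric X d x y \<le> e x y"
    by auto
  note yoneda = smyth_imp_yoneda[where 'i = 'i, OF assms(3,4,1) _ _ lower upper]
  have "e x x = 0" if "x \<in> X" for x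
    using lower[OF that that] by (simp add: lower_hemimetric_self)
  moreover have "d x y = way_below TYPE('i) X e x y" if "x \<in> X" "y \<in> X" for x y
    using s that by (intro yoneda(3)) auto
  moreover have "net_complete TYPE('i) X e (yoneda_topology X e)" using s by (intro yoneda(1)) auto
  moreover have "net_continuous TYPE('i) X d (yoneda_topology X e)" using s by (intro yoneda(2)) auto
  ultimately show ?yoneda by blast
qed

end
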